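(* Let $S$ be a $\mathrm{Cu}$-semigroup satisfying (O5), (O6), and Edwards' condition, and let $K$ be a closed subcone of $F(S)$ with $0\in K$. Let $M\in(0,\infty)$. Assume that for all $x,y\in S$, $\widehat x|_K\le\widehat y|_K$ implies $\widehat x\le M\widehat y$ (on all of $F(S)$). Then $K=F(S)$.
   Context: A $\mathrm{Cu}$-semigroup is a commutative, partially ordered monoid $S$ (order compatible with addition) with $0\le x$ for all $x$, such that: (O1) every increasing sequence has a supremum; (O2) every $x\in S$ is the supremum of a sequence $(x_n)_n$ with $x_n\ll x_{n+1}$ for all $n$; (O3) $x_1\ll x_2$ and $y_1\ll y_2$ imply $x_1+y_1\ll x_2+y_2$; (O4) $\sup_n(x_n+y_n)=\sup_nx_n+\sup_ny_n$ for increasing sequences. Here $x\ll y$ means: for every increasing sequence $(y_n)_n$ with $y\le\sup_ny_n$ there is $n$ with $x\le y_n$. (O5): for all $x'\ll x\le y$ there is $z$ with $x'+z\le y\le x+z$; moreover, if $x+w\le y$ and $w'\ll w$, then $z$ may be chosen with $w'\ll z$. (O6): for all $x'\ll x\le y+z$ there exist $y',z'$ with $x'\le y'+z'$, $y'\le y,x$ and $z'\le z,x$. A functional on $S$ is an order-preserving monoid homomorphism $\lambda\colon S\to[0,\infty]$ preserving suprema of increasing sequences. $F(S)$ is the set of functionals, with pointwise addition and pointwise multiplication by scalars in $(0,\infty)$, endowed with the compact Hausdorff topology in which a net $\lambda_j\to\lambda$ iff $\limsup_j\lambda_j(x')\le\lambda(x)\le\liminf_j\lambda_j(x)$ for all $x'\ll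 x$ in $S$. For $x\in S$, $\widehat x\colon F(S)\to[0,\infty]$ is $\widehat x(\lambda)=\lambda(x)$. $0\in F(S)$ is the zero functional. A subcone of $F(S)$ is a subset closed under addition and under multiplication by scalars in $(0,\infty)$ (and having a neutral element, automatic here since it contains $0$). Edwards' condition: for all $\lambda\in F(S)$ and $x,y\in S$, $\inf\{\lambda_1(x)+\lambda_2(y):\lambda_1,\lambda_2\in F(S),\ \lambda_1+\lambda_2=\lambda\}=\sup\{\lambda(z): z\in S,\ z\le x,\ z\le y\}$. *)

theory Defs
  imports "HOL-Analysis.Analysis" "HOL-Library.Lub_Glb"
begin

text \<open>
  A semigroup \<open>S\<close> is a type of class \<^class>\<open>ordered_comm_monoid_add\<close>: a commutative monoid with a
  compatible partial order. Conditions on \<open>S\<close> are predicates on that type. As suprema need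
  not exist in an arbitrary such type, ``\<open>x\<close> is the supremum of the sequence \<open>s\<close>'' is written
  \<open>isLub UNIV (range s) x\<close>.
\<close>

definition way_below :: "'a::order \<Rightarrow> 'a \<Rightarrow> bool" (infix \<open>\<lless>\<close> 50)
  where "x \<lless> y \<longleftrightarrow>
    (\<forall>s u. incseq s \<and> isLub UNIV (range s) u \<and> y \<le> u \<longrightarrow> (\<exists>n. x \<le> s n))"

definition cu_semigroup :: "'a::ordered_comm_monoid_add itself \<Rightarrow> bool"
  where "cu_semigroup _ \<longleftrightarrow>
    (\<forall>x::'a. 0 \<le> x) \<and>
    \<comment> \<open>(O1)\<close>
    (\<forall>s::nat \<Rightarrow> 'a. incseq s \<longrightarrow> (\<exists>x. isLub UNIV (range s) x)) \<and>
    \<comment> \<open>(O2)\<close>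
    (\<forall>x::'a. \<exists>s. (\<forall>n. s n \<lless> s (Suc n)) \<and> isLub UNIV (range s) x) \<and>
    \<comment> \<open>(O3)\<close>
    (\<forall>x1 x2 y1 y2 :: 'a. x1 \<lless> x2 \<and> y1 \<lless> y2 \<longrightarrow> x1 + y1 \<lless> x2 + y2) \<and>
    \<comment> \<open>(O4)\<close>
    (\<forall>(s::nat \<Rightarrow> 'a) t x y. incseq s \<and> incseq t \<and>
        isLub UNIV (range s) x \<and> isLub UNIV (range t) y \<longrightarrow>
        isLub UNIV (range (\<lambda>n. s n + t n)) (x + y))"

definition cu_O5 :: "'a::ordered_comm_monoid_add itself \<Rightarrow> bool"
  where "cu_O5 _ \<longleftrightarrow>
    (\<forall>x' x y :: 'a. x' \<lless> x \<and> x \<le> y \<longrightarrow> (\<exists>z. x' + z \<le> y \<and> y \<le> x + z)) \<and>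
    (\<forall>x' x y w' w :: 'a. x' \<lless> x \<and> x \<le> y \<and> x + w \<le> y \<and> w' \<lless> w \<longrightarrow>
        (\<exists>z. x' + z \<le> y \<and> y \<le> x + z \<and> w' \<lless> z))"

definition cu_O6 :: "'a::ordered_comm_monoid_add itself \<Rightarrow> bool"
  where "cu_O6 _ \<longleftrightarrow>
    (\<forall>x' x y z :: 'a. x' \<lless> x \<and> x \<le> y + z \<longrightarrow>
        (\<exists>y' z'. x' \<le> y' + z' \<and> y' \<le> y \<and> y' \<le> x \<and> z' \<le> z \<and> z' \<le> x))"

definition functionals :: "('a::ordered_comm_monoid_add \<Rightarrow> ennreal) set"
  where "functionals = {l. mono l \<and> l 0 = 0 \<and> (\<forall>x y. l (x + y) = l x + l y) \<and>
    (\<forall>s x. incseq s \<and> isLub UNIV (range s) x \<longrightarrow> l x = (SUP n. l (s n)))}"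

definition edwards :: "'a::ordered_comm_monoid_add itself \<Rightarrow> bool"
  where "edwards _ \<longleftrightarrow>
    (\<forall>l \<in> functionals. \<forall>x y :: 'a.
        Inf {l1 x + l2 y | l1 l2.
              l1 \<in> functionals \<and> l2 \<in> functionals \<and> (\<lambda>z. l1 z + l2 z) = l} =
        Sup {l z | z. z \<le> x \<and> z \<le> y})"

text \<open>
  Convergence along a filter; a net is the case where \<open>F\<close> is the filter of tails of a directed set.
\<close>

definition functional_converges ::
    "('i \<Rightarrow> 'a::ordered_comm_monoid_add \<Rightarrow> ennreal) \<Rightarrow> ('a \<Rightarrow> ennreal) \<Rightarrow> 'i filter \<Rightarrow> bool"
  where "functional_converges f l F \<longleftrightarrow>
    (\<forall>x' x. x' \<lless> x \<longrightarrow>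
        Limsup F (\<lambda>j. f j x') \<le> l x \<and> l x \<le> Liminf F (\<lambda>j. f j x))"

text \<open>
  A topology is determined by its convergent nets: a set is open iff every net converging to
  one of its points is eventually in it. Every net in \<open>F(S)\<close> can be replaced by the filter on \<open>F(S)\<close>
  that it generates, so it suffices to quantify over filters on \<open>F(S)\<close>. That convergence in the
  resulting topology is the prescribed one is lemma \<open>limitin_functional_topology\<close> below.
\<close>

definition functional_topology :: "('a::ordered_comm_monoid_add \<Rightarrow> ennreal) topology"
  where "functional_topology = topology (\<lambda>U. U \<subseteq> functionals \<and>
    (\<forall>l F. l \<in> U \<and> F \<le> principal functionals \<and> functional_converges (\<lambda>k. k) l F \<longrightarrow>
        eventually (\<lambda>k. k \<in> U) F))"

definition subcone :: "('a::ordered_comm_monoid_add \<Rightarrow> ennreal) set \<Rightarrow> bool"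
  where "subcone K \<longleftrightarrow> K \<subseteq> functionals \<and>
    (\<forall>l1 \<in> K. \<forall>l2 \<in> K. (\<lambda>x. l1 x + l2 x) \<in> K) \<and>
    (\<forall>c::real. \<forall>l \<in> K. 0 < c \<longrightarrow> (\<lambda>x. ennreal c * l x) \<in> K)"

lemma openin_functional_topology:
  "openin functional_topology U \<longleftrightarrow> U \<subseteq> functionals \<and>
    (\<forall>l F. l \<in> U \<and> F \<le> principal functionals \<and> functional_converges (\<lambda>k. k) l F \<longrightarrow>
        eventually (\<lambda>k. k \<in> U) F)"
proof -
  have "istopology (\<lambda>U. U \<subseteq> functionals \<and>
    (\<forall>l F. l \<in> U \<and> F \<le> principal functionals \<and> functional_converges (\<lambda>k. k) l F \<longrightarrow>
        eventually (\<lambda>k. k \<in> U) F))" (is "istopology ?P")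
    unfolding istopology_def
  proof (intro conjI allI impI)
    fix A B assume "?P A" "?P B"
    then show "A \<inter> B \<subseteq> functionals" by blast
  next
    fix A B l F assume AB: "?P A" "?P B"
      and l: "l \<in> A \<inter> B \<and> F \<le> principal functionals \<and> functional_converges (\<lambda>k. k) l F"
    have "eventually (\<lambda>k. k \<in> A) F" "eventually (\<lambda>k. k \<in> B) F"
      using AB l by blast+
    then show "eventually (\<lambda>k. k \<in> A \<inter> B) F"
      by eventually_elim simp
  next
    fix \<U> assume "\<forall>U\<in>\<U>. ?P U"
    then show "\<Union>\<U> \<subseteq> functionals" by blast
  next
    fix \<U> l F assume P: "\<forall>U\<in>\<U>. ?P U"
      and l: "l \<in> \<Union>\<U> \<and> F \<le> principal functionals \<and> functional_converges (\<lambda>k. k) l F"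
    obtain U where U: "U \<in> \<U>" "l \<in> U" using l by blast
    have "eventually (\<lambda>k. k \<in> U) F" using P U l by blast
    then show "eventually (\<lambda>k. k \<in> \<Union>\<U>) F"
      using U by (auto elim: eventually_mono)
  qed
  from topology_inverse'[OF this] show ?thesis
    unfolding functional_topology_def by (rule fun_cong)
qed

lemma topspace_functional_topology [simp]: "topspace functional_topology = functionals"
proof
  show "topspace functional_topology \<subseteq> functionals"
    using openin_topspace openin_functional_topology by blast
  have "openin functional_topology functionals"
    unfolding openin_functional_topology by (simp add: le_principal)
  then show "functionals \<subseteq> topspace functional_topology"
    by (rule openin_subset)
qed

lemma way_below_interpolate:
  fixes x y :: "'a::ordered_comm_monoid_add"
  assumes S: "cu_semigroup TYPE('a)" and xy: "x \<lless> y"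
  obtains z where "x \<lless> z" "z \<lless> y"
proof -
  obtain s where s: "\<And>n. s n \<lless> s (Suc n)" "isLub UNIV (range s) y"
    using S unfolding cu_semigroup_def by meson
  have le: "a \<le> b" if "a \<lless> b" for a b :: 'a
  proof -
    have "isLub UNIV (range (\<lambda>_::nat. b)) b"
      by (simp add: isLub_def leastP_def isUb_def setle_def setge_def)
    then show ?thesis
      using that unfolding way_below_def by (metis incseq_const order_refl)
  qed
  have "incseq s"
    by (rule incseq_SucI) (simp add: le s)
  then obtain n where n: "x \<le> s n"
    using xy s(2) unfolding way_below_def by blast
  have "x \<lless> s (Suc n)"
    using s(1)[of n] n unfolding way_below_def by (meson order_trans)
  moreover have "s (Suc (Suc n)) \<le> y"
    using s(2) by (meson isLubD2 rangeI)
  then have "s (Suc n) \<lless> y"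
    using s(1)[of "Suc n"] unfolding way_below_def by (meson order_trans)
  ultimately show ?thesis by (rule that)
qed

lemma limitin_functional_topology:
  fixes f :: "'i \<Rightarrow> 'a::ordered_comm_monoid_add \<Rightarrow> ennreal"
  assumes S: "cu_semigroup TYPE('a)"
  shows "limitin functional_topology f l F \<longleftrightarrow>
    l \<in> functionals \<and> eventually (\<lambda>j. f j \<in> functionals) F \<and> functional_converges f l F"
proof (intro iffI conjI)
  assume lim: "limitin functional_topology f l F"
  then show l: "l \<in> functionals"
    using limitin_topspace by fastforce
  have ev: "eventually (\<lambda>j. f j \<in> U) F" if "openin functional_topology U" "l \<in> U" for U
    using lim that by (simp add: limitin_def)
  show "eventually (\<lambda>j. f j \<in> functionals) F"
    using ev[of functionals] l openin_topspace[of functional_topology] by simp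
  show "functional_converges f l F"
    unfolding functional_converges_def
  proof (intro allI impI conjI)
    fix x' x :: 'a assume xx: "x' \<lless> x"
    show "Limsup F (\<lambda>j. f j x') \<le> l x"
      unfolding Limsup_le_iff
    proof (intro allI impI)
      fix r assume r: "l x < r"
      let ?U = "{k \<in> functionals. \<exists>y. x' \<lless> y \<and> k y < r}"
      have "openin functional_topology ?U"
        unfolding openin_functional_topology
      proof (intro conjI allI impI)
        fix m :: "'a \<Rightarrow> ennreal" and G assume m: "m \<in> ?U \<and> G \<le> principal functionals \<and> functional_converges (\<lambda>k. k) m G"
        then obtain y where y: "x' \<lless> y" "m y < r" by blast
        obtain z where z: "x' \<lless> z" "z \<lless> y"
          using way_below_interpolate[OF S y(1)] .
        have "Limsup G (\<lambda>k. k z) < r"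
          using m z(2) y(2) unfolding functional_converges_def by (meson le_less_trans)
        then have "eventually (\<lambda>k. k z < r) G" by (rule Limsup_lessD)
        moreover have "eventually (\<lambda>k. k \<in> functionals) G"
          using m by (simp add: le_principal)
        ultimately show "eventually (\<lambda>k. k \<in> ?U) G"
          by eventually_elim (use z in blast)
      qed auto
      from ev[OF this] have "eventually (\<lambda>j. f j \<in> ?U) F"
        using l xx r by blast
      then show "eventually (\<lambda>j. f j x' < r) F"
      proof eventually_elim
        case (elim j)
        then obtain y where y: "x' \<lless> y" "f j y < r" "mono (f j)"
          by (auto simp: functionals_def)
        obtain z where "x' \<lless> z" "z \<lless> y"
          using way_below_interpolate[OF S y(1)] .
        have "isLub UNIV (range (\<lambda>_::nat. y)) y"
          by (simp add: isLub_def leastP_def isUb_def setle_def setge_def)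
        then have "x' \<le> y"
          using y(1) unfolding way_below_def by (metis incseq_const order_refl)
        then show ?case using y monoD le_less_trans by metis
      qed
    qed
    show "l x \<le> Liminf F (\<lambda>j. f j x)"
      unfolding le_Liminf_iff
    proof (intro allI impI)
      fix r assume r: "r < l x"
      let ?U = "{k \<in> functionals. r < k x}"
      have "openin functional_topology ?U"
        unfolding openin_functional_topology
      proof (intro conjI allI impI)
        fix m :: "'a \<Rightarrow> ennreal" and G assume m: "m \<in> ?U \<and> G \<le> principal functionals \<and> functional_converges (\<lambda>k. k) m G"
        then have "r < Liminf G (\<lambda>k. k x)"
          using xx unfolding functional_converges_def by (auto intro: less_le_trans)
        then have "eventually (\<lambda>k. r < k x) G" by (rule less_LiminfD)
        moreover have "eventually (\<lambda>k. k \<in> functionals) G"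
          using m by (simp add: le_principal)
        ultimately show "eventually (\<lambda>k. k \<in> ?U) G"
          by eventually_elim simp
      qed auto
      from ev[OF this] have "eventually (\<lambda>j. f j \<in> ?U) F"
        using l r by blast
      then show "eventually (\<lambda>j. r < f j x) F"
        by eventually_elim simp
    qed
  qed
next
  assume R: "l \<in> functionals \<and> eventually (\<lambda>j. f j \<in> functionals) F \<and> functional_converges f l F"
  let ?G = "filtermap f F"
  have "functional_converges (\<lambda>k. k) l ?G"
    unfolding functional_converges_def Limsup_le_iff le_Liminf_iff eventually_filtermap
    using R[unfolded functional_converges_def Limsup_le_iff le_Liminf_iff] by blast
  moreover have "?G \<le> principal functionals"
    using R by (simp add: le_principal eventually_filtermap)
  ultimately have "eventually (\<lambda>k. k \<in> U) ?G" if "openin functional_topology U" "l \<in> U" for U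
    using that unfolding openin_functional_topology by blast
  then show "limitin functional_topology f l F"
    using R by (simp add: limitin_def eventually_filtermap)
qed

end

theory Submission
  imports Defs
begin

text \<open>
  The constant \<open>M\<close> can be improved to \<open>1\<close>: apply the hypothesis to the positive and negative parts of
  \<open>x - y\<close>, which Edwards' condition makes disjoint. If \<open>l\<close> is not in \<open>K\<close>, finitely many inequalities
  \<open>a < k x\<close>, \<open>k y < b\<close> hold at \<open>k = l\<close> but at no \<open>k \<in> K\<close>. A Gordan-type theorem of the alternative then
  yields nonnegative weights, which after scaling and rounding become multiplicities of elements
  \<open>X\<close>, \<open>Y\<close> of the semigroup with \<open>X \<le> Y\<close> on \<open>K\<close> but \<open>l X > l Y\<close>. So \<open>K\<close> is dense in \<open>F(S)\<close> even for
  pointwise convergence, which is finer than the topology of \<open>F(S)\<close>.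
\<close>

section \<open>The way-below relation and functionals\<close>

lemma way_below_imp_le:
  fixes x y :: "'a::order"
  assumes "x \<lless> y"
  shows "x \<le> y"
proof -
  have "isLub UNIV (range (\<lambda>_::nat. y)) y"
    by (simp add: isLub_def leastP_def isUb_def setle_def setge_def)
  with assms show ?thesis
    unfolding way_below_def by (metis incseq_const order_refl)
qed

lemma functional_mono: "l \<in> functionals \<Longrightarrow> x \<le> y \<Longrightarrow> l x \<le> l y"
  by (simp add: functionals_def monoD)

lemma functional_zero: "l \<in> functionals \<Longrightarrow> l 0 = 0"
  by (simp add: functionals_def)

lemma functional_add: "l \<in> functionals \<Longrightarrow> l (x + y) = l x + l y"
  by (simp add: functionals_def)

lemma functional_sum:
  assumes "l \<in> functionals"
  shows "l (\<Sum>i\<in>I. f i) = (\<Sum>i\<in>I. l (f i))"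
  using functional_zero[OF assms] functional_add[OF assms]
  by (induction I rule: infinite_finite_induct) auto

lemma way_below_sum:
  fixes f g :: "'i \<Rightarrow> 'a::ordered_comm_monoid_add"
  assumes S: "cu_semigroup TYPE('a)" and "\<And>i. i \<in> I \<Longrightarrow> f i \<lless> g i"
  shows "(\<Sum>i\<in>I. f i) \<lless> (\<Sum>i\<in>I. g i)"
proof -
  have "(0::'a) \<le> x" for x
    using S by (simp add: cu_semigroup_def)
  then have "(0::'a) \<lless> 0"
    by (simp add: way_below_def)
  moreover have "x1 + y1 \<lless> x2 + y2" if "x1 \<lless> x2" "y1 \<lless> y2" for x1 x2 y1 y2 :: 'a
    using S that unfolding cu_semigroup_def by blast
  ultimately show ?thesis
    using assms(2) by (induction I rule: infinite_finite_induct) auto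
qed

section \<open>Transfer of inequalities from the subcone to all functionals\<close>

text \<open>After division by \<open>n\<close> the error \<open>c / n\<close> tends to 0. This turns
  estimates for \<open>n\<close>-fold sums, with an error independent of \<open>n\<close>, into
  exact ones.\<close>

lemma ennreal_le_if_multiples_le:
  fixes a b c :: ennreal
  assumes c: "c < top" and le: "\<And>n::nat. 0 < n \<Longrightarrow> of_nat n * a \<le> of_nat n * b + c"
  shows "a \<le> b"
proof (cases "b = top")
  case False
  \<comment> \<open>The case \<open>n = 1\<close> makes \<open>a\<close> finite, so the rest can be
    done in the reals.\<close>
  have "a \<le> b + c"
    using le[of 1] by simp
  moreover have "b + c < top"
    using c False by (simp add: less_top)
  ultimately have "a < top"
    by (rule le_less_trans)
  then obtain a' b' c' where abc: "a = ennreal a'" "0 \<le> a'" "b = ennreal b'" "0 \<le> b'"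
    "c = ennreal c'" "0 \<le> c'"
    using False c by (metis enn2real_nonneg ennreal_enn2real less_top)
  have *: "real n * a' \<le> real n * b' + c'" if "0 < n" for n
  proof -
    have "ennreal (real n * a') \<le> ennreal (real n * b' + c')"
      using le[OF that] abc by (simp add: ennreal_mult ennreal_plus ennreal_of_nat_eq_real_of_nat)
    then show ?thesis
      using abc by (subst (asm) ennreal_le_iff) auto
  qed
  have "a' \<le> b'"
  proof (rule ccontr)
    assume "\<not> a' \<le> b'"
    then obtain n :: nat where n: "c' < real n * (a' - b')"
      using reals_Archimedean3[of "a' - b'"] by auto
    have "0 < n"
      using n abc by (cases n) auto
    then show False
      using *[of n] n by (simp add: algebra_simps)
  qed
  then show ?thesis
    using abc by (simp add: ennreal_leI)
qed simp

text \<open>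
  Let \<open>z\<close> almost realise \<open>x \<and> y\<close> at \<open>l\<close>. Morally \<open>u = x - z\<close> and \<open>v = y - z\<close> are the positive and
  the negative part of \<open>x - y\<close>; then \<open>u \<le> v\<close> on \<open>K\<close> gives \<open>u \<le> M v\<close> everywhere, and disjointness of
  \<open>u\<close> and \<open>v\<close> forces \<open>u = 0\<close>. The complements provided by (O5) only exist up to the gap between
  some \<open>z' \<lless> z\<close> and \<open>z\<close>. For an \<open>n\<close>-fold sum along a chain \<open>z\<^sub>0 \<lless> \<dots> \<lless> z\<^sub>n\<close> the gap telescopes
  to at most one copy of \<open>y\<close>, which is negligible after division by \<open>n\<close>.
\<close>
lemma le_on_functionals:
  fixes K :: "('a::ordered_comm_monoid_add \<Rightarrow> ennreal) set" and M :: real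
  assumes S: "cu_semigroup TYPE('a)" and O5: "cu_O5 TYPE('a)" and E: "edwards TYPE('a)"
    and K: "K \<subseteq> functionals"
    and M: "\<And>x y. (\<forall>l \<in> K. l x \<le> l y) \<Longrightarrow> (\<forall>l \<in> functionals. l x \<le> ennreal M * l y)"
    and xy: "\<And>l. l \<in> K \<Longrightarrow> l x \<le> l y"
    and l: "l \<in> functionals"
  shows "l x \<le> l y"
proof (cases "l y = top")
  case False
  \<comment> \<open>The error term bounds \<open>l u\<close> for the complement \<open>u\<close>
    chosen below: for a splitting of \<open>l\<close> into \<open>l1\<close> and \<open>l2\<close>,
    the summand 1 bounds \<open>l1 u\<close> and the rest bounds \<open>l2 u\<close>.\<close>
  have step: "of_nat n * l x \<le> of_nat n * l y + (1 + ennreal M * (1 + l y))" if n: "0 < n" for n :: nat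
  proof -
    \<comment> \<open>The tolerance per copy: \<open>n\<close> copies of it cost 1.\<close>
    define e :: ennreal where "e = ennreal (1 / real n)"
    have e: "0 < e" "of_nat n * e = 1"
      using n by (simp_all add: e_def ennreal_of_nat_eq_real_of_nat flip: ennreal_mult)
    define m where "m = (SUP z\<in>{z. z \<le> x \<and> z \<le> y}. l z)"
    have "m \<le> l y"
      unfolding m_def by (rule SUP_least) (use functional_mono[OF l] in auto)
    then have m_fin: "m < top"
      using False by (simp add: le_less_trans less_top)
    \<comment> \<open>First \<open>z\<close> nearly attains the supremum \<open>m\<close>, then a
      term of an (O2)-sequence of \<open>z\<close> nearly attains \<open>l z\<close>. As the first
      inequality is strict, the same \<open>e\<close> serves for both.\<close>
    have "\<exists>z k s. z \<le> x \<and> z \<le> y \<and> (\<forall>i. s i \<lless> s (Suc i)) \<and> (\<forall>i. s i \<le> z) \<and> m < l (s (k::nat)) + e"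
    proof -
      have "0 \<le> x" "0 \<le> y"
        using S unfolding cu_semigroup_def by blast+
      then have "(SUP z\<in>{z. z \<le> x \<and> z \<le> y}. l z + e) = m + e"
        unfolding m_def by (intro ennreal_SUP_add_left) auto
      moreover have "m < m + e"
        using ennreal_add_left_cancel_less[of m 0 e] m_fin e by auto
      ultimately obtain z where z: "z \<le> x" "z \<le> y" "m < l z + e"
        using less_SUP_iff[of m "\<lambda>z. l z + e" "{z. z \<le> x \<and> z \<le> y}"] by auto
      obtain s where s: "\<And>i. s i \<lless> s (Suc i)" "isLub UNIV (range s) z"
        using S unfolding cu_semigroup_def by meson
      have "incseq s"
        by (rule incseq_SucI) (simp add: s way_below_imp_le)
      then have lz: "l z = (SUP i. l (s i))"
        using l s(2) by (simp add: functionals_def)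
      have "(SUP i. l (s i) + e) = l z + e"
        unfolding lz by (rule ennreal_SUP_add_left) simp
      then obtain k where "m < l (s k) + e"
        using z(3) less_SUP_iff[of m "\<lambda>i. l (s i) + e" UNIV] by auto
      moreover have "s i \<le> z" for i
        using s(2) by (rule isLubD2) simp
      ultimately show ?thesis
        using z(1,2) s(1) by (intro exI[of _ z] exI[of _ k] exI[of _ s]) simp
    qed
    then obtain z k s where z: "z \<le> x" "z \<le> y" and s: "\<And>i. s i \<lless> s (Suc i)" "\<And>i. s i \<le> z"
      and k: "m < l (s (k::nat)) + e"
      by blast
    define Z' Z where "Z' = (\<Sum>i<n. s (k + i))" and "Z = (\<Sum>i<n. s (k + Suc i))"
    have Z'Z: "Z' \<lless> Z"
      unfolding Z'_def Z_def by (rule way_below_sum[OF S]) (simp add: s)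
    \<comment> \<open>Both sides group the same \<open>n + 1\<close> terms from \<open>s k\<close>
      to \<open>s (k + n)\<close>.\<close>
    have tele: "s k + Z = Z' + s (k + n)"
      unfolding Z'_def Z_def using sum.lessThan_Suc_shift[of "\<lambda>i. s (k + i)" n] by simp
    define nx ny where "nx = (\<Sum>i<n. x)" and "ny = (\<Sum>i<n. y)"
    have nxy: "f nx = of_nat n * f x" "f ny = of_nat n * f y" if "f \<in> functionals" for f
      by (simp_all add: nx_def ny_def functional_sum[OF that])
    have Zle: "Z \<le> (\<Sum>i<n. z)"
      unfolding Z_def by (rule sum_mono) (simp add: s)
    have "Z \<le> nx" "Z \<le> ny"
      using Zle z sum_mono[of "{..<n}" "\<lambda>_. z" "\<lambda>_. x"] sum_mono[of "{..<n}" "\<lambda>_. z" "\<lambda>_. y"]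
      by (auto simp: nx_def ny_def)
    then obtain u v where u: "Z' + u \<le> nx" "nx \<le> Z + u" and v: "Z' + v \<le> ny" "ny \<le> Z + v"
      using O5 Z'Z unfolding cu_O5_def by metis
    \<comment> \<open>Comparing \<open>n\<close> copies of \<open>x\<close> and of \<open>y\<close>
      on \<open>K\<close> and cancelling \<open>f Z'\<close> leaves the gap between
      \<open>Z'\<close> and \<open>Z\<close>, which \<open>tele\<close> bounds by
      \<open>f y\<close>.\<close>
    have uvK: "f u \<le> f (v + y)" if "f \<in> K" for f
    proof (cases "f y = top")
      case True
      then show ?thesis
        using that K by (auto simp: functional_add)
    next
      case False
      have f: "f \<in> functionals"
        using that K by blast
      have "f (s (k + n)) \<le> f y" "\<And>i. f (s i) \<le> f y"
        using functional_mono[OF f] s(2) z(2) order_trans by blast+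
      then have fs: "f (s i) < top" for i
        using False by (metis less_top order_le_less_trans)
      have "f Z' = (\<Sum>i<n. f (s (k + i)))"
        unfolding Z'_def by (rule functional_sum[OF f])
      then have fZ': "f Z' < top"
        using fs by simp
      have "f Z \<le> f (s k) + f Z"
        by simp
      also have "\<dots> = f Z' + f (s (k + n))"
        using arg_cong[OF tele, of f] by (simp add: functional_add[OF f])
      also have "\<dots> \<le> f Z' + f y"
        using \<open>f (s (k + n)) \<le> f y\<close> by (rule add_left_mono)
      finally have fZ: "f Z \<le> f Z' + f y" .
      have "f Z' + f u \<le> of_nat n * f x"
        using functional_mono[OF f u(1)] by (simp add: functional_add[OF f] nxy[OF f])
      also have "\<dots> \<le> of_nat n * f y"
        by (intro mult_left_mono xy that) simp
      also have "\<dots> \<le> f Z + f v"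
        using functional_mono[OF f v(2)] by (simp add: functional_add[OF f] nxy[OF f])
      also have "\<dots> \<le> f Z' + (f v + f y)"
        using add_right_mono[OF fZ, of "f v"] by (simp add: add_ac)
      finally show ?thesis
        using fZ' by (auto simp: functional_add[OF f] ennreal_add_left_cancel_le)
    qed
    \<comment> \<open>Because \<open>m < l (s k) + e\<close>, Edwards' condition splits
      \<open>l\<close> so that \<open>l1\<close> hardly distinguishes \<open>x\<close> from
      \<open>s k\<close>, and \<open>l2\<close> hardly \<open>y\<close> from
      \<open>s k\<close>.\<close>
    have "Inf {l1 x + l2 y | l1 l2. l1 \<in> functionals \<and> l2 \<in> functionals \<and> (\<lambda>z. l1 z + l2 z) = l} = m"
      using E l unfolding edwards_def m_def by (simp add: image_Collect)
    then obtain l1 l2 where l12: "l1 \<in> functionals" "l2 \<in> functionals" "\<And>z. l1 z + l2 z = l z"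
      and lt: "l1 x + l2 y < l (s k) + e"
      using k by (smt (verit, best) Inf_less_iff mem_Collect_eq)
    have le: "l1 x + l2 y \<le> l1 (s k) + l2 (s k) + e"
      using lt l12(3)[of "s k"] by simp
    have fin: "l1 (s k) < top" "l2 (s k) < top" "l1 y < top" "l2 y < top"
    proof -
      have "l1 y + l2 y < top"
        using False l12(3)[of y] by (simp add: less_top)
      then show "l1 y < top" "l2 y < top"
        by (simp_all add: ennreal_add_less_top)
      then show "l1 (s k) < top" "l2 (s k) < top"
        using functional_mono[OF l12(1), of "s k" y] functional_mono[OF l12(2), of "s k" y] s(2) z(2)
        by (meson order_trans order_le_less_trans)+
    qed
    \<comment> \<open>The finite value \<open>l2 (s k) \<le> l2 y\<close> is cancelled;
      \<open>l2y\<close> is symmetric.\<close>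
    have l1x: "l1 x \<le> l1 (s k) + e"
    proof -
      have "l2 (s k) + l1 x \<le> l1 x + l2 y"
        using functional_mono[OF l12(2), of "s k" y] s(2) z(2)
        by (metis add.commute add_left_mono order_trans)
      also note le
      finally have "l2 (s k) + l1 x \<le> l2 (s k) + (l1 (s k) + e)"
        by (simp add: add_ac)
      then show ?thesis
        using fin by (auto simp: ennreal_add_left_cancel_le)
    qed
    have l2y: "l2 y \<le> l2 (s k) + e"
    proof -
      have "l1 (s k) + l2 y \<le> l1 x + l2 y"
        using functional_mono[OF l12(1), of "s k" x] s(2) z(1)
        by (metis add_right_mono order_trans)
      also note le
      finally have "l1 (s k) + l2 y \<le> l1 (s k) + (l2 (s k) + e)"
        by (simp add: add_ac)
      then show ?thesis
        using fin by (auto simp: ennreal_add_left_cancel_le)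
    qed
    have "mono s"
      by (rule incseq_SucI) (simp add: s way_below_imp_le)
    \<comment> \<open>Used for \<open>l1\<close>, \<open>x\<close>, \<open>u\<close> and for
      \<open>l2\<close>, \<open>y\<close>, \<open>v\<close>. All \<open>n\<close> terms of
      \<open>Z'\<close> lie above \<open>s k\<close>, so the part \<open>w\<close> left over from
      \<open>n\<close> copies of \<open>t\<close> has value at most \<open>n * e\<close>, which is
      1.\<close>
    have gap: "f w \<le> 1" if f: "f \<in> functionals" and w: "Z' + w \<le> (\<Sum>i<n. t)"
      and t: "f t \<le> f (s k) + e" and fin: "f (s k) < top" "f y < top" for f w t
    proof -
      have "f Z' = (\<Sum>i<n. f (s (k + i)))"
        unfolding Z'_def by (rule functional_sum[OF f])
      moreover have "f (s i) < top" for i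
        using functional_mono[OF f, of "s i" y] s(2)[of i] z(2) fin(2) by (meson order_trans order_le_less_trans)
      ultimately have fZ': "f Z' < top"
        by simp
      have "(\<Sum>i<n. f (s k)) \<le> (\<Sum>i<n. f (s (k + i)))"
        by (intro sum_mono functional_mono[OF f] monoD[OF \<open>mono s\<close>]) simp
      then have ge: "of_nat n * f (s k) \<le> f Z'"
        using \<open>f Z' = _\<close> by simp
      have "f Z' + f w \<le> of_nat n * f t"
        using functional_mono[OF f w] by (simp add: functional_add[OF f] functional_sum[OF f])
      also have "\<dots> \<le> of_nat n * (f (s k) + e)"
        by (intro mult_left_mono t) simp
      also have "\<dots> \<le> f Z' + 1"
        using ge e(2) by (simp add: distrib_left)
      finally show ?thesis
        using fZ' by (auto simp: ennreal_add_left_cancel_le)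
    qed
    have l1u: "l1 u \<le> 1"
      using gap[OF l12(1) u(1)[unfolded nx_def] l1x] fin by simp
    have l2v: "l2 v \<le> 1"
      using gap[OF l12(2) v(1)[unfolded ny_def] l2y] fin by simp
    \<comment> \<open>On \<open>l2\<close> it is \<open>v\<close> that is small, so the comparison
      of \<open>u\<close> with \<open>v + y\<close> on \<open>K\<close> is transferred to
      \<open>l2\<close> at the price of the factor \<open>M\<close>.\<close>
    have "l2 u \<le> ennreal M * l2 (v + y)"
      using M[of u "v + y"] uvK l12(2) by blast
    also have "\<dots> \<le> ennreal M * (1 + l y)"
    proof (intro mult_left_mono)
      have "l2 y \<le> l y"
        using l12(3)[of y] by (metis add.commute le_iff_add)
      then show "l2 (v + y) \<le> 1 + l y"
        using l2v by (simp add: functional_add[OF l12(2)] add_mono)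
    qed simp
    finally have lu: "l u \<le> 1 + ennreal M * (1 + l y)"
      using l1u l12(3)[of u] by (metis add_mono)
    have "l Z \<le> of_nat n * l y"
      using functional_mono[OF l \<open>Z \<le> ny\<close>] nxy[OF l] by simp
    then have "l Z + l u \<le> of_nat n * l y + (1 + ennreal M * (1 + l y))"
      using lu by (rule add_mono)
    moreover have "of_nat n * l x \<le> l Z + l u"
      using functional_mono[OF l u(2)] by (simp add: functional_add[OF l] nxy[OF l])
    ultimately show ?thesis
      by (rule order_trans[rotated])
  qed
  have "1 + ennreal M * (1 + l y) < top"
    using False by (simp add: ennreal_mult_less_top less_top)
  then show ?thesis
    using step by (rule ennreal_le_if_multiples_le)
qed simp

section \<open>Theorems of the alternative for convex cones\<close>

text \<open>The pairs \<open>(f p, g p)\<close> form a convex cone in the plane that misses the open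
  positive quadrant; \<open>(a, b)\<close> is the normal of a separating line.\<close>

lemma two_functions_alternative:
  fixes P :: "('i \<Rightarrow> real) set" and f g :: "('i \<Rightarrow> real) \<Rightarrow> real"
  assumes f: "\<And>p q s t. p \<in> P \<Longrightarrow> q \<in> P \<Longrightarrow> f (\<lambda>i. s * p i + t * q i) = s * f p + t * f q"
    and g: "\<And>p q s t. p \<in> P \<Longrightarrow> q \<in> P \<Longrightarrow> g (\<lambda>i. s * p i + t * q i) = s * g p + t * g q"
    and P: "\<And>p q s t. p \<in> P \<Longrightarrow> q \<in> P \<Longrightarrow> 0 < s \<Longrightarrow> 0 < t \<Longrightarrow> (\<lambda>i. s * p i + t * q i) \<in> P"
    and no: "\<And>p. p \<in> P \<Longrightarrow> f p \<le> 0 \<or> g p \<le> 0"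
  obtains a b :: real where "0 \<le> a" "0 \<le> b" "0 < a \<or> 0 < b" "\<And>p. p \<in> P \<Longrightarrow> a * f p + b * g p \<le> 0"
proof (cases "(\<forall>p\<in>P. f p \<le> 0) \<or> (\<forall>p\<in>P. g p \<le> 0)")
  case True
  then show ?thesis
    using that[of 1 0] that[of 0 1] by auto
next
  case False
  then obtain p0 q0 where p0: "p0 \<in> P" "0 < f p0" and q0: "q0 \<in> P" "0 < g q0"
    by force
  \<comment> \<open>Otherwise the positive combination with coefficients \<open>g q - f q\<close>
    and \<open>f p - g p\<close> has both values equal to the positive number
    \<open>f p * g q - g p * f q\<close>.\<close>
  have key: "f p * g q \<le> g p * f q" if p: "p \<in> P" "0 < f p" and q: "q \<in> P" "0 < g q" for p q
  proof (rule ccontr)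
    assume *: "\<not> f p * g q \<le> g p * f q"
    have gp: "g p \<le> 0" and fq: "f q \<le> 0"
      using no[OF p(1)] no[OF q(1)] p q by auto
    have comb: "s * f p + t * f q \<le> 0 \<or> s * g p + t * g q \<le> 0" if "0 < s" "0 < t" for s t
      using no[OF P[OF p(1) q(1) that]] f[OF p(1) q(1)] g[OF p(1) q(1)] by simp
    define s t where "s = g q - f q" and "t = f p - g p"
    have "0 < s" "0 < t"
      using gp fq p q by (auto simp: s_def t_def)
    moreover have "s * f p + t * f q = f p * g q - g p * f q" "s * g p + t * g q = f p * g q - g p * f q"
      by (simp_all add: s_def t_def algebra_simps)
    ultimately show False
      using comb[of s t] * by linarith
  qed
  have neg: "g p < 0" if p: "p \<in> P" "0 < f p" for p
  proof -
    have "0 < f p * g q0"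
      using p q0 by simp
    then have "g p \<noteq> 0"
      using key[OF p q0] by auto
    then show ?thesis
      using no[OF p(1)] p by auto
  qed
  \<comment> \<open>The least weight making \<open>f + b * g\<close> nonpositive wherever
    \<open>f\<close> is positive; by \<open>ub\<close> it does not exceed the bounds imposed where
    \<open>g\<close> is positive.\<close>
  define b where "b = (SUP p\<in>{p\<in>P. 0 < f p}. f p / - g p)"
  have ub: "f p / - g p \<le> - f q / g q" if "p \<in> P" "0 < f p" "q \<in> P" "0 < g q" for p q
  proof -
    have "0 < - g p"
      using neg[OF that(1,2)] by simp
    then show ?thesis
      using key[OF that] that(4) by (simp add: field_simps)
  qed
  have bdd: "bdd_above ((\<lambda>p. f p / - g p) ` {p\<in>P. 0 < f p})"
    using ub[OF _ _ q0] by (intro bdd_aboveI[where M = "- f q0 / g q0"]) auto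
  have lb: "f p / - g p \<le> b" if "p \<in> P" "0 < f p" for p
    unfolding b_def by (rule cSUP_upper[OF _ bdd]) (use that in auto)
  have b0: "0 < b"
    using lb[OF p0] neg[OF p0] p0 by (smt (verit) divide_pos_pos)
  have "1 * f p + b * g p \<le> 0" if p: "p \<in> P" for p
  proof -
    consider "0 < f p" | "0 < g p" | "f p \<le> 0" "g p \<le> 0"
      by linarith
    then show ?thesis
    proof cases
      case 1
      have "f p / - g p \<le> b"
        by (rule lb[OF p 1])
      then have "f p \<le> b * - g p"
        using neg[OF p 1] by (subst (asm) pos_divide_le_eq) auto
      then show ?thesis
        by simp
    next
      case 2
      have "b \<le> - f p / g p"
        unfolding b_def by (rule cSUP_least) (use p0 ub[OF _ _ p 2] in auto)
      then have "b * g p \<le> - f p"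
        using 2 by (subst (asm) pos_le_divide_eq) auto
      then show ?thesis
        by simp
    next
      case 3
      then show ?thesis
        using b0 by (simp add: add_nonpos_nonpos mult_nonneg_nonpos)
    qed
  qed
  then show ?thesis
    using that[of 1 b] b0 by simp
qed

text \<open>Gordan's alternative for a cone that need not be closed. In the induction step, the
  weighted sum for \<open>I\<close> and the coordinate \<open>j\<close> are never both positive,
  which reduces to two functions.\<close>

lemma finite_functions_alternative:
  fixes P :: "('i \<Rightarrow> real) set"
  assumes "finite I" "I \<noteq> {}"
    and "\<And>p q s t. p \<in> P \<Longrightarrow> q \<in> P \<Longrightarrow> 0 < s \<Longrightarrow> 0 < t \<Longrightarrow> (\<lambda>i. s * p i + t * q i) \<in> P"
    and "\<And>p. p \<in> P \<Longrightarrow> \<exists>i\<in>I. p i \<le> 0"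
  shows "\<exists>w. (\<forall>i\<in>I. 0 \<le> w i) \<and> (\<exists>i\<in>I. 0 < w i) \<and> (\<forall>p\<in>P. (\<Sum>i\<in>I. w i * p i) \<le> (0::real))"
  using assms
proof (induction I arbitrary: P rule: finite_ne_induct)
  case (singleton j)
  then show ?case
    by (intro exI[of _ "\<lambda>_. 1"]) auto
next
  case (insert j I)
  \<comment> \<open>Where coordinate \<open>j\<close> is positive, the nonpositive coordinate must
    lie in \<open>I\<close>, so the induction hypothesis applies.\<close>
  let ?Q = "{p\<in>P. 0 < p j}"
  have "\<exists>w. (\<forall>i\<in>I. 0 \<le> w i) \<and> (\<exists>i\<in>I. 0 < w i) \<and> (\<forall>p\<in>?Q. (\<Sum>i\<in>I. w i * p i) \<le> (0::real))"
  proof (rule insert.IH)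
    show "(\<lambda>i. s * p i + t * q i) \<in> ?Q" if "p \<in> ?Q" "q \<in> ?Q" "0 < s" "0 < t" for p q s t
      using insert.prems(1)[of p q s t] that by (simp add: add_pos_pos)
    show "\<exists>i\<in>I. p i \<le> 0" if "p \<in> ?Q" for p
      using insert.prems(2)[of p] that by auto
  qed
  then obtain w where w: "\<forall>i\<in>I. 0 \<le> w i" "\<exists>i\<in>I. 0 < w i" "\<And>p. p \<in> ?Q \<Longrightarrow> (\<Sum>i\<in>I. w i * p i) \<le> 0"
    by blast
  obtain a b where ab: "0 \<le> a" "0 \<le> b" "0 < a \<or> 0 < b"
    "\<And>p. p \<in> P \<Longrightarrow> a * (\<Sum>i\<in>I. w i * p i) + b * p j \<le> 0"
  proof (rule two_functions_alternative[of P "\<lambda>p. \<Sum>i\<in>I. w i * p i" "\<lambda>p. p j"])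
    show "(\<Sum>i\<in>I. w i * (s * p i + t * q i)) = s * (\<Sum>i\<in>I. w i * p i) + t * (\<Sum>i\<in>I. w i * q i)"
      for p q s t
      by (simp add: algebra_simps sum.distrib sum_distrib_left)
    show "(\<Sum>i\<in>I. w i * p i) \<le> 0 \<or> p j \<le> 0" if "p \<in> P" for p
      using w(3)[of p] that by force
  qed (use insert.prems in auto)
  have "(\<Sum>i\<in>insert j I. (if i = j then b else a * w i) * p i) = b * p j + a * (\<Sum>i\<in>I. w i * p i)"
    for p
  proof -
    have "(\<Sum>i\<in>I. (if i = j then b else a * w i) * p i) = (\<Sum>i\<in>I. a * (w i * p i))"
      using insert.hyps by (intro sum.cong) auto
    then show ?thesis
      using insert.hyps by (simp add: sum_distrib_left)
  qed
  then have "\<forall>p\<in>P. (\<Sum>i\<in>insert j I. (if i = j then b else a * w i) * p i) \<le> 0"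
    using ab(4) by (simp add: add.commute)
  moreover have "\<forall>i\<in>insert j I. 0 \<le> (if i = j then b else a * w i)"
    using ab w by auto
  moreover have "\<exists>i\<in>insert j I. 0 < (if i = j then b else a * w i)"
    using ab(3)
  proof
    assume "0 < a"
    obtain i where "i \<in> I" "0 < w i"
      using w(2) by blast
    then show ?thesis
      using \<open>0 < a\<close> insert.hyps by (intro bexI[of _ i]) auto
  qed auto
  ultimately show ?case
    by (intro exI[of _ "\<lambda>i. if i = j then b else a * w i"]) blast
qed

section \<open>Approximation of a functional from within the subcone\<close>

lemma ennreal_add_le: "ennreal (u + v) \<le> ennreal u + ennreal v"
  by (cases "0 \<le> u"; cases "0 \<le> v") (auto simp: ennreal_neg ennreal_leI simp flip: ennreal_plus)

text \<open>A Hahn-Banach type separation whose separating inequality is realised by two semigroup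
  elements, so that \<open>le\<close> can refute it.\<close>

lemma exists_in_subcone_between:
  fixes K :: "('a::ordered_comm_monoid_add \<Rightarrow> ennreal) set" and a b :: "'a \<Rightarrow> real"
  assumes K: "subcone K" and zero: "(\<lambda>x. 0) \<in> K"
    and le: "\<And>x y. (\<And>k. k \<in> K \<Longrightarrow> k x \<le> k y) \<Longrightarrow> l x \<le> l y"
    and l: "l \<in> functionals"
    and A: "finite A" "\<And>x. x \<in> A \<Longrightarrow> 0 \<le> a x \<and> ennreal (a x) < l x"
    and B: "finite B" "\<And>y. y \<in> B \<Longrightarrow> l y < ennreal (b y)"
  shows "\<exists>k\<in>K. (\<forall>x\<in>A. ennreal (a x) < k x) \<and> (\<forall>y\<in>B. k y < ennreal (b y))"
proof (rule ccontr)
  assume no: "\<not> ?thesis"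
  have Kf: "k \<in> functionals" if "k \<in> K" for k
    using K that unfolding subcone_def by blast
  have K_add: "(\<lambda>x. k1 x + k2 x) \<in> K" if "k1 \<in> K" "k2 \<in> K" for k1 k2
    using K that unfolding subcone_def by blast
  have K_mult: "(\<lambda>x. ennreal c * k x) \<in> K" if "k \<in> K" "0 < c" for k and c :: real
    using K that unfolding subcone_def by blast
  define I where "I = Inl ` A \<union> Inr ` B"
  \<comment> \<open>Without any constraint the zero functional would be a witness.\<close>
  have I: "finite I" "I \<noteq> {}"
    using A(1) B(1) no zero by (auto simp: I_def)
  have sum_I: "(\<Sum>i\<in>I. h i) = (\<Sum>x\<in>A. h (Inl x)) + (\<Sum>y\<in>B. h (Inr y))" for h :: "_ \<Rightarrow> real"
  proof -
    have "(\<Sum>i\<in>I. h i) = sum h (Inl ` A) + sum h (Inr ` B)"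
      unfolding I_def by (rule sum.union_disjoint) (use A(1) B(1) in auto)
    then show ?thesis
      by (simp add: sum.reindex)
  qed
  \<comment> \<open>The real vectors below \<open>(k x - r a, r b - k y)\<close>. As \<open>ennreal\<close> truncates negative numbers to \<open>0\<close>,
    the condition \<open>p (Inr y) \<le> r * b y\<close> has to be imposed separately.\<close>
  define P where "P = {p. \<exists>k\<in>K. \<exists>r>0. (\<forall>x\<in>A. ennreal (p (Inl x) + r * a x) \<le> k x) \<and>
    (\<forall>y\<in>B. p (Inr y) \<le> r * b y \<and> k y \<le> ennreal (r * b y - p (Inr y)))}"
  have "\<exists>w. (\<forall>i\<in>I. 0 \<le> w i) \<and> (\<exists>i\<in>I. 0 < w i) \<and> (\<forall>p\<in>P. (\<Sum>i\<in>I. w i * p i) \<le> (0::real))"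
  proof (rule finite_functions_alternative[OF I])
    fix p q :: "'a + 'a \<Rightarrow> real" and s t :: real assume "p \<in> P" "q \<in> P" and st: "0 < s" "0 < t"
    then obtain k1 r1 k2 r2 where k1: "k1 \<in> K" "0 < r1" "\<And>x. x \<in> A \<Longrightarrow> ennreal (p (Inl x) + r1 * a x) \<le> k1 x"
      "\<And>y. y \<in> B \<Longrightarrow> p (Inr y) \<le> r1 * b y \<and> k1 y \<le> ennreal (r1 * b y - p (Inr y))"
      and k2: "k2 \<in> K" "0 < r2" "\<And>x. x \<in> A \<Longrightarrow> ennreal (q (Inl x) + r2 * a x) \<le> k2 x"
      "\<And>y. y \<in> B \<Longrightarrow> q (Inr y) \<le> r2 * b y \<and> k2 y \<le> ennreal (r2 * b y - q (Inr y))"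
      unfolding P_def by blast
    define k where "k = (\<lambda>x. ennreal s * k1 x + ennreal t * k2 x)"
    have "k \<in> K"
      unfolding k_def by (intro K_add K_mult k1 k2 st)
    moreover have "0 < s * r1 + t * r2"
      using st k1(2) k2(2) by (simp add: add_pos_pos)
    moreover have "ennreal (s * p (Inl x) + t * q (Inl x) + (s * r1 + t * r2) * a x) \<le> k x" if "x \<in> A" for x
    proof -
      have "ennreal (s * p (Inl x) + t * q (Inl x) + (s * r1 + t * r2) * a x)
          = ennreal (s * (p (Inl x) + r1 * a x) + t * (q (Inl x) + r2 * a x))"
        by (simp add: algebra_simps)
      also have "\<dots> \<le> ennreal (s * (p (Inl x) + r1 * a x)) + ennreal (t * (q (Inl x) + r2 * a x))"
        by (rule ennreal_add_le)
      also have "\<dots> \<le> k x"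
        unfolding k_def using k1(3)[OF that] k2(3)[OF that] st
        by (simp add: ennreal_mult' add_mono mult_left_mono)
      finally show ?thesis .
    qed
    moreover have "s * p (Inr y) + t * q (Inr y) \<le> (s * r1 + t * r2) * b y \<and>
      k y \<le> ennreal ((s * r1 + t * r2) * b y - (s * p (Inr y) + t * q (Inr y)))" if "y \<in> B" for y
    proof -
      have "s * p (Inr y) \<le> s * (r1 * b y)" "t * q (Inr y) \<le> t * (r2 * b y)"
        using k1(4)[OF that] k2(4)[OF that] st by simp_all
      moreover have "k y \<le> ennreal (s * (r1 * b y - p (Inr y))) + ennreal (t * (r2 * b y - q (Inr y)))"
        unfolding k_def using k1(4)[OF that] k2(4)[OF that] st
        by (simp add: ennreal_mult' add_mono mult_left_mono)
      moreover have "\<dots> = ennreal (s * (r1 * b y - p (Inr y)) + t * (r2 * b y - q (Inr y)))"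
        using k1(4)[OF that] k2(4)[OF that] st by (intro ennreal_plus[symmetric]) simp_all
      ultimately show ?thesis
        by (simp add: algebra_simps)
    qed
    ultimately show "(\<lambda>i. s * p i + t * q i) \<in> P"
      unfolding P_def by blast
  next
    fix p assume "p \<in> P"
    then obtain k r where k: "k \<in> K" "0 < r" "\<And>x. x \<in> A \<Longrightarrow> ennreal (p (Inl x) + r * a x) \<le> k x"
      "\<And>y. y \<in> B \<Longrightarrow> p (Inr y) \<le> r * b y \<and> k y \<le> ennreal (r * b y - p (Inr y))"
      unfolding P_def by blast
    show "\<exists>i\<in>I. p i \<le> 0"
    proof (rule ccontr)
      assume "\<not> ?thesis"
      then have pos: "\<And>x. x \<in> A \<Longrightarrow> 0 < p (Inl x)" "\<And>y. y \<in> B \<Longrightarrow> 0 < p (Inr y)"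
        by (force simp: I_def)+
      \<comment> \<open>Dividing by the scale \<open>r\<close> turns positive coordinates of
        \<open>p\<close> into exactly the strict bounds excluded by \<open>no\<close>.\<close>
      let ?k = "\<lambda>x. ennreal (1 / r) * k x"
      have "?k \<in> K"
        using k by (intro K_mult) simp_all
      moreover have "ennreal (a x) < ?k x" if "x \<in> A" for x
      proof -
        have "ennreal (a x) < ennreal (1 / r * (p (Inl x) + r * a x))"
          using k(2) pos(1)[OF that] A(2)[OF that] by (intro ennreal_lessI) (simp_all add: field_simps add_pos_nonneg)
        also have "\<dots> = ennreal (1 / r) * ennreal (p (Inl x) + r * a x)"
          using k(2) by (intro ennreal_mult') simp
        also have "\<dots> \<le> ?k x"
          using k(3)[OF that] by (rule mult_left_mono) simp
        finally show ?thesis .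
      qed
      moreover have "?k y < ennreal (b y)" if "y \<in> B" for y
      proof -
        have "0 < r * b y"
          using k(4)[OF that] pos(2)[OF that] by linarith
        then have "0 < b y"
          using k(2) by (simp add: zero_less_mult_iff)
        have "?k y \<le> ennreal (1 / r) * ennreal (r * b y - p (Inr y))"
          using k(4)[OF that] by (intro mult_left_mono) simp_all
        also have "\<dots> = ennreal (1 / r * (r * b y - p (Inr y)))"
          using k(2) by (intro ennreal_mult'[symmetric]) simp
        also have "\<dots> < ennreal (b y)"
          using k(2) pos(2)[OF that] \<open>0 < b y\<close> by (intro ennreal_lessI) (simp_all add: field_simps)
        finally show ?thesis .
      qed
      ultimately have "\<exists>k\<in>K. (\<forall>x\<in>A. ennreal (a x) < k x) \<and> (\<forall>y\<in>B. k y < ennreal (b y))"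
        by (intro bexI[of _ ?k]) auto
      with no show False
        by contradiction
    qed
  qed
  then obtain w where w: "\<And>i. i \<in> I \<Longrightarrow> 0 \<le> w i" "\<exists>i\<in>I. 0 < w i"
    and wP: "\<And>p. p \<in> P \<Longrightarrow> (\<Sum>i\<in>I. w i * p i) \<le> 0"
    by blast
  define \<alpha> \<beta> where "\<alpha> x = w (Inl x)" and "\<beta> y = w (Inr y)" for x y
  have \<alpha>0: "0 \<le> \<alpha> x" if "x \<in> A" for x
    using w(1) that by (simp add: \<alpha>_def I_def)
  have \<beta>0: "0 \<le> \<beta> y" if "y \<in> B" for y
    using w(1) that by (simp add: \<beta>_def I_def)
  have b0: "0 < b y" if "y \<in> B" for y
    using B(2)[OF that] by (metis ennreal_neg not_less not_less_zero)
  define D where "D = (\<Sum>x\<in>A. \<alpha> x * a x) - (\<Sum>y\<in>B. \<beta> y * b y)"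
  \<comment> \<open>Real bounds \<open>\<sigma>\<close> and \<open>\<tau>\<close> stand in for the
    values of \<open>k\<close>, since \<open>k x\<close> may be infinite.\<close>
  have main: "(\<Sum>x\<in>A. \<alpha> x * \<sigma> x) - (\<Sum>y\<in>B. \<beta> y * \<tau> y) \<le> r * D"
    if "k \<in> K" "0 < r" "\<And>x. x \<in> A \<Longrightarrow> ennreal (\<sigma> x) \<le> k x" "\<And>y. y \<in> B \<Longrightarrow> 0 \<le> \<tau> y \<and> k y \<le> ennreal (\<tau> y)"
    for k r \<sigma> \<tau>
  proof -
    define p where "p = case_sum (\<lambda>x. \<sigma> x - r * a x) (\<lambda>y. r * b y - \<tau> y)"
    have "p \<in> P"
      unfolding P_def p_def using that by (intro CollectI bexI[of _ k] exI[of _ r]) auto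
    from wP[OF this] show ?thesis
      unfolding sum_I by (simp add: p_def \<alpha>_def \<beta>_def D_def algebra_simps sum_subtractf sum_distrib_left)
  qed
  have D0: "0 \<le> D"
    using main[OF zero, of 1 "\<lambda>_. 0" "\<lambda>_. 0"] by simp
  have main0: "(\<Sum>x\<in>A. \<alpha> x * \<sigma> x) \<le> (\<Sum>y\<in>B. \<beta> y * \<tau> y)"
    if "k \<in> K" "\<And>x. x \<in> A \<Longrightarrow> ennreal (\<sigma> x) \<le> k x" "\<And>y. y \<in> B \<Longrightarrow> 0 \<le> \<tau> y \<and> k y \<le> ennreal (\<tau> y)"
    for k \<sigma> \<tau>
  \<comment> \<open>\<open>main\<close> holds for every scale \<open>r\<close>, so letting
    \<open>r\<close> tend to 0 removes \<open>D\<close>; the denominator \<open>D + 1\<close> covers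
    \<open>D = 0\<close>.\<close>
  proof (rule field_le_epsilon)
    fix e :: real assume e: "0 < e"
    have "(\<Sum>x\<in>A. \<alpha> x * \<sigma> x) - (\<Sum>y\<in>B. \<beta> y * \<tau> y) \<le> e / (D + 1) * D"
      using D0 e by (intro main[OF that(1)] that(2,3)) simp_all
    also have "\<dots> \<le> e"
      using D0 e by (simp add: field_simps)
    finally show "(\<Sum>x\<in>A. \<alpha> x * \<sigma> x) \<le> (\<Sum>y\<in>B. \<beta> y * \<tau> y) + e"
      by simp
  qed
  have "\<exists>c. a x < c \<and> ennreal c \<le> l x" if x: "x \<in> A" for x
  proof -
    obtain d where d: "ennreal (a x) < d" "d < l x"
      using A(2)[OF x] dense by blast
    then obtain c where "d = ennreal c" "0 \<le> c"
      by (cases d) auto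
    then show ?thesis
      using d by (auto intro!: exI[of _ c] simp: ennreal_less_iff A(2)[OF x])
  qed
  then obtain a' where a': "\<And>x. x \<in> A \<Longrightarrow> a x < a' x \<and> ennreal (a' x) \<le> l x"
    by metis
  have "\<exists>c. 0 \<le> c \<and> c < b y \<and> l y \<le> ennreal c" if y: "y \<in> B" for y
  proof -
    obtain c where "l y = ennreal c" "0 \<le> c"
      using B(2)[OF y] by (cases "l y") auto
    then show ?thesis
      using B(2)[OF y] by (auto intro!: exI[of _ c] simp: ennreal_less_iff)
  qed
  then obtain b' where b': "\<And>y. y \<in> B \<Longrightarrow> 0 \<le> b' y \<and> b' y < b y \<and> l y \<le> ennreal (b' y)"
    by metis
  have a'0: "0 \<le> a' x" if "x \<in> A" for x
    using a'[OF that] A(2)[OF that] by linarith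
  \<comment> \<open>The slacks \<open>a' x - a x\<close> and \<open>b y - b' y\<close> are positive
    and some weight is positive, so the difference exceeds \<open>D\<close>, which is
    nonnegative.\<close>
  have gap: "(\<Sum>y\<in>B. \<beta> y * b' y) < (\<Sum>x\<in>A. \<alpha> x * a' x)"
  proof -
    have "0 < (\<Sum>i\<in>I. w i * case_sum (\<lambda>x. a' x - a x) (\<lambda>y. b y - b' y) i)"
    proof -
      obtain i where i: "i \<in> I" "0 < w i"
        using w(2) by blast
      have pos: "0 < case_sum (\<lambda>x. a' x - a x) (\<lambda>y. b y - b' y) j" if "j \<in> I" for j
        using that a' b' by (auto simp: I_def)
      show ?thesis
        using i pos w(1) by (intro sum_pos2[OF I(1) i(1)]) (auto simp: less_imp_le)
    qed
    then show ?thesis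
      using D0 unfolding sum_I by (simp add: \<alpha>_def \<beta>_def D_def algebra_simps sum_subtractf)
  qed
  \<comment> \<open>Rounding the multiplicities costs at most one copy of each \<open>a' x\<close>
    and \<open>b' y\<close>; \<open>N\<close> times the gap outweighs this.\<close>
  obtain N :: nat where N: "(\<Sum>x\<in>A. a' x) + (\<Sum>y\<in>B. b' y)
      < real N * ((\<Sum>x\<in>A. \<alpha> x * a' x) - (\<Sum>y\<in>B. \<beta> y * b' y))"
    using reals_Archimedean3[of "(\<Sum>x\<in>A. \<alpha> x * a' x) - (\<Sum>y\<in>B. \<beta> y * b' y)"] gap by auto
  \<comment> \<open>Rounding up to a \<^emph>\<open>positive\<close> integer makes \<open>k Y\<close> infinite as soon as some \<open>k y\<close> is, even where
    \<open>\<beta> y = 0\<close>; \<open>main0\<close> says nothing about such \<open>k\<close>.\<close>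
  define m n where "m x = nat \<lfloor>real N * \<alpha> x\<rfloor>" and "n y = Suc (nat \<lfloor>real N * \<beta> y\<rfloor>)" for x y
  have m: "real (m x) \<le> real N * \<alpha> x" "real N * \<alpha> x - 1 \<le> real (m x)" if "x \<in> A" for x
    using \<alpha>0[OF that] of_int_floor_le[of "real N * \<alpha> x"] real_of_int_floor_gt_diff_one[of "real N * \<alpha> x"]
    by (simp_all add: m_def of_nat_nat)
  have n: "real N * \<beta> y \<le> real (n y)" "real (n y) \<le> real N * \<beta> y + 1" if "y \<in> B" for y
  proof -
    have "real (n y) = of_int \<lfloor>real N * \<beta> y\<rfloor> + 1"
      using \<beta>0[OF that] by (simp add: n_def of_nat_nat)
    then show "real N * \<beta> y \<le> real (n y)" "real (n y) \<le> real N * \<beta> y + 1"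
      by linarith+
  qed
  define X Y where "X = (\<Sum>x\<in>A. \<Sum>i<m x. x)" and "Y = (\<Sum>y\<in>B. \<Sum>i<n y. y)"
  have XY: "k X = (\<Sum>x\<in>A. of_nat (m x) * k x)" "k Y = (\<Sum>y\<in>B. of_nat (n y) * k y)"
    if "k \<in> functionals" for k
    by (simp_all add: X_def Y_def functional_sum[OF that])
  have "k X \<le> k Y" if k: "k \<in> K" for k
  proof (cases "\<exists>y\<in>B. k y = top")
    case True
    then obtain y where y: "y \<in> B" "k y = top"
      by blast
    have "of_nat (n y) * k y = top"
      using y by (simp add: n_def ennreal_mult_top distrib_right)
    moreover have "of_nat (n y) * k y \<le> k Y"
      unfolding XY(2)[OF Kf[OF k]] by (rule member_le_sum[OF y(1) _ B(1)]) simp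
    ultimately show ?thesis
      by (simp add: top.extremum_unique)
  next
    case False
    define \<sigma> where "\<sigma> x = enn2real (k x)" for x
    have \<sigma>B: "k y = ennreal (\<sigma> y)" if "y \<in> B" for y
      using False that by (auto simp: \<sigma>_def less_top)
    have mk: "of_nat (m x) * k x = ennreal (real (m x) * \<sigma> x)" if x: "x \<in> A" for x
    proof (cases "k x = top")
      case True
      have "\<alpha> x \<le> 0"
      proof (rule ccontr)
        assume "\<not> \<alpha> x \<le> 0"
        \<comment> \<open>Since \<open>k x\<close> is infinite, any real is a lower bound for it;
          this one would violate \<open>main0\<close>. Hence \<open>\<alpha> x = 0\<close> and
          \<open>x\<close> does not occur in \<open>X\<close>.\<close>
        define T where "T = ((\<Sum>y\<in>B. \<beta> y * \<sigma> y) + 1) / \<alpha> x"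
        have "(\<Sum>z\<in>A. \<alpha> z * (if z = x then T else 0)) \<le> (\<Sum>y\<in>B. \<beta> y * \<sigma> y)"
          by (rule main0[OF k]) (use True \<sigma>B in \<open>auto simp: \<sigma>_def\<close>)
        moreover have "(\<Sum>z\<in>A. \<alpha> z * (if z = x then T else 0)) = \<alpha> x * T"
          using A(1) x by (simp add: if_distrib[of "\<lambda>t. _ * t"] cong: if_cong)
        ultimately show False
          using \<open>\<not> \<alpha> x \<le> 0\<close> by (simp add: T_def)
      qed
      then have "m x = 0"
        using \<alpha>0[OF x] by (simp add: m_def)
      then show ?thesis
        by simp
    next
      case False
      then show ?thesis
        by (simp add: \<sigma>_def ennreal_mult less_top ennreal_of_nat_eq_real_of_nat)
    qed
    have \<sigma>0: "0 \<le> \<sigma> x" for x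
      by (simp add: \<sigma>_def)
    have "(\<Sum>x\<in>A. \<alpha> x * \<sigma> x) \<le> (\<Sum>y\<in>B. \<beta> y * \<sigma> y)"
    proof (rule main0[OF k])
      show "ennreal (\<sigma> x) \<le> k x" for x
        by (cases "k x") (simp_all add: \<sigma>_def)
    qed (use \<sigma>B \<sigma>0 in auto)
    then have "real N * (\<Sum>x\<in>A. \<alpha> x * \<sigma> x) \<le> real N * (\<Sum>y\<in>B. \<beta> y * \<sigma> y)"
      by (rule mult_left_mono) simp
    moreover have "(\<Sum>x\<in>A. real (m x) * \<sigma> x) \<le> real N * (\<Sum>x\<in>A. \<alpha> x * \<sigma> x)"
      unfolding sum_distrib_left by (rule sum_mono) (use m \<sigma>0 in \<open>simp add: mult_right_mono flip: mult.assoc\<close>)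
    moreover have "real N * (\<Sum>y\<in>B. \<beta> y * \<sigma> y) \<le> (\<Sum>y\<in>B. real (n y) * \<sigma> y)"
      unfolding sum_distrib_left by (rule sum_mono) (use n \<sigma>0 in \<open>simp add: mult_right_mono flip: mult.assoc\<close>)
    ultimately have fin: "(\<Sum>x\<in>A. real (m x) * \<sigma> x) \<le> (\<Sum>y\<in>B. real (n y) * \<sigma> y)"
      by linarith
    have "k X = (\<Sum>x\<in>A. ennreal (real (m x) * \<sigma> x))"
      unfolding XY(1)[OF Kf[OF k]] by (rule sum.cong[OF refl mk])
    also have "\<dots> = ennreal (\<Sum>x\<in>A. real (m x) * \<sigma> x)"
      by (rule sum_ennreal) (simp add: \<sigma>0)
    also have "\<dots> \<le> ennreal (\<Sum>y\<in>B. real (n y) * \<sigma> y)"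
      by (rule ennreal_leI[OF fin])
    also have "\<dots> = (\<Sum>y\<in>B. ennreal (real (n y) * \<sigma> y))"
      by (rule sum_ennreal[symmetric]) (simp add: \<sigma>0)
    also have "\<dots> = k Y"
      unfolding XY(2)[OF Kf[OF k]]
      by (rule sum.cong[OF refl]) (simp add: \<sigma>B \<sigma>0 ennreal_mult ennreal_of_nat_eq_real_of_nat)
    finally show ?thesis .
  qed
  then have lXY: "l X \<le> l Y"
    by (rule le)
  \<comment> \<open>Evaluating \<open>X\<close> and \<open>Y\<close> at \<open>l\<close> and undoing
    the rounding contradicts the choice of \<open>N\<close>.\<close>
  have "ennreal (\<Sum>x\<in>A. real (m x) * a' x) = (\<Sum>x\<in>A. of_nat (m x) * ennreal (a' x))"
    using a'0 by (simp add: ennreal_mult ennreal_of_nat_eq_real_of_nat flip: sum_ennreal)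
  also have "\<dots> \<le> l X"
    unfolding XY(1)[OF l] by (intro sum_mono mult_left_mono) (use a' in auto)
  also note lXY
  also have "l Y \<le> (\<Sum>y\<in>B. of_nat (n y) * ennreal (b' y))"
    unfolding XY(2)[OF l] by (intro sum_mono mult_left_mono) (use b' in auto)
  also have "\<dots> = ennreal (\<Sum>y\<in>B. real (n y) * b' y)"
    using b' by (simp add: ennreal_mult ennreal_of_nat_eq_real_of_nat flip: sum_ennreal)
  finally have "(\<Sum>x\<in>A. real (m x) * a' x) \<le> (\<Sum>y\<in>B. real (n y) * b' y)"
    using b' by (subst (asm) ennreal_le_iff) (auto intro!: sum_nonneg)
  moreover have "(\<Sum>x\<in>A. (real N * \<alpha> x - 1) * a' x) \<le> (\<Sum>x\<in>A. real (m x) * a' x)"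
    by (intro sum_mono mult_right_mono m a'0)
  moreover have "(\<Sum>y\<in>B. real (n y) * b' y) \<le> (\<Sum>y\<in>B. (real N * \<beta> y + 1) * b' y)"
    by (intro sum_mono mult_right_mono n) (use b' in auto)
  ultimately have "(\<Sum>x\<in>A. (real N * \<alpha> x - 1) * a' x) \<le> (\<Sum>y\<in>B. (real N * \<beta> y + 1) * b' y)"
    by linarith
  then show False
    using N by (simp add: algebra_simps sum.distrib sum_subtractf sum_distrib_left)
qed

section \<open>From pointwise approximation to the topology of F(S)\<close>

text \<open>A basic neighbourhood in the product topology restricts finitely many coordinates, and a
  neighbourhood in \<open>ennreal\<close> contains a half-open interval on each side of the point
  where there is room.\<close>

lemma in_pointwise_closure:
  fixes K :: "('a \<Rightarrow> ennreal) set"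
  assumes *: "\<And>A B a b. finite A \<Longrightarrow> finite B \<Longrightarrow> (\<And>x. x \<in> A \<Longrightarrow> 0 \<le> a x \<and> ennreal (a x) < l x) \<Longrightarrow>
      (\<And>y. y \<in> B \<Longrightarrow> l y < ennreal (b y)) \<Longrightarrow>
      \<exists>k\<in>K. (\<forall>x\<in>A. ennreal (a x) < k x) \<and> (\<forall>y\<in>B. k y < ennreal (b y))"
  shows "l \<in> closure K"
  unfolding closure_iff_nhds_not_empty
proof (intro allI impI)
  fix V U :: "('a \<Rightarrow> ennreal) set" assume "U \<subseteq> V" "open U" "l \<in> U"
  then obtain X where X: "l \<in> (\<Pi>\<^sub>E i\<in>UNIV. X i)" "\<And>i. open (X i)" "finite {i. X i \<noteq> UNIV}"
    "(\<Pi>\<^sub>E i\<in>UNIV. X i) \<subseteq> U"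
    unfolding open_fun_def by (auto dest!: product_topology_open_contains_basis)
  define J where "J = {i. X i \<noteq> UNIV}"
  have lX: "l i \<in> X i" for i
    using X(1) by auto
  have "\<exists>a. 0 \<le> a \<and> ennreal a < l i \<and> {ennreal a <.. l i} \<subseteq> X i" if "l i \<noteq> 0" for i
  proof -
    have "0 < l i"
      using that by (simp add: zero_less_iff_neq_zero)
    then obtain c where c: "c < l i" "{c <.. l i} \<subseteq> X i"
      using open_left[OF X(2) lX, of 0 i] by blast
    moreover obtain a where "c = ennreal a" "0 \<le> a"
      using c(1) by (cases c) auto
    ultimately show ?thesis
      by blast
  qed
  then obtain a where a: "\<And>i. l i \<noteq> 0 \<Longrightarrow> 0 \<le> a i \<and> ennreal (a i) < l i \<and> {ennreal (a i) <.. l i} \<subseteq> X i"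
    by metis
  have "\<exists>b. l i < ennreal b \<and> {l i ..< ennreal b} \<subseteq> X i" if "l i \<noteq> top" for i
  proof -
    have "l i < top"
      using that by (simp add: less_top)
    then obtain c where c: "l i < c" "{l i ..< c} \<subseteq> X i"
      using open_right[OF X(2) lX, of i top] by blast
    \<comment> \<open>The bound \<open>c\<close> may be infinite; a point strictly below it is a
      real.\<close>
    moreover obtain d where "l i < d" "d < c"
      using dense[OF c(1)] by blast
    moreover from this obtain b where "d = ennreal b"
      by (cases d) auto
    ultimately have "{l i ..< ennreal b} \<subseteq> X i" "l i < ennreal b"
      by (auto simp: subset_eq)
    then show ?thesis
      by blast
  qed
  then obtain b where b: "\<And>i. l i \<noteq> top \<Longrightarrow> l i < ennreal (b i) \<and> {l i ..< ennreal (b i)} \<subseteq> X i"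
    by metis
  \<comment> \<open>No lower bound can be imposed at value 0 and no upper bound at value
    \<open>top\<close>.\<close>
  obtain k where k: "k \<in> K" "\<And>x. x \<in> J \<Longrightarrow> l x \<noteq> 0 \<Longrightarrow> ennreal (a x) < k x"
    "\<And>x. x \<in> J \<Longrightarrow> l x \<noteq> top \<Longrightarrow> k x < ennreal (b x)"
    using *[of "{x\<in>J. l x \<noteq> 0}" "{x\<in>J. l x \<noteq> top}" a b] a b X(3) unfolding J_def by auto
  have "k i \<in> X i" for i
  proof (cases "i \<in> J")
    case True
    show ?thesis
    proof (cases "k i \<le> l i")
      case le: True
      show ?thesis
      proof (cases "l i = 0")
        case True
        then show ?thesis
          using le lX[of i] by simp
      next
        case False
        then show ?thesis
          using a[OF False] k(2)[OF True False] le by auto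
      qed
    next
      case False
      then have "l i \<noteq> top"
        by auto
      then show ?thesis
        using b k(3)[OF True] False by (auto simp: subset_eq)
    qed
  qed (simp add: J_def)
  then have "k \<in> U"
    using X(4) by auto
  then show "K \<inter> V \<noteq> {}"
    using k(1) \<open>U \<subseteq> V\<close> by blast
qed

text \<open>Limsup and Liminf both equal the pointwise limit, and \<open>l x' \<le> l x\<close>
  bridges the two arguments.\<close>

lemma functional_converges_of_pointwise:
  assumes l: "l \<in> functionals" and F: "F \<noteq> bot"
    and lim: "\<And>x. ((\<lambda>j. f j x) \<longlongrightarrow> l x) F"
  shows "functional_converges f l F"
  unfolding functional_converges_def
  using lim_imp_Limsup[OF F lim] lim_imp_Liminf[OF F lim] functional_mono[OF l way_below_imp_le]
  by simp

theorem theoremB5: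
  fixes K :: "('a::ordered_comm_monoid_add \<Rightarrow> ennreal) set" and M :: real
  assumes "cu_semigroup TYPE('a)"
    and "cu_O5 TYPE('a)"
    and "cu_O6 TYPE('a)"
    and "edwards TYPE('a)"
    and "subcone K"
    and "closedin functional_topology K"
    and "(\<lambda>x. 0) \<in> K"
    and "0 < M"
    and "\<And>x y. (\<forall>l \<in> K. l x \<le> l y) \<Longrightarrow> (\<forall>l \<in> functionals. l x \<le> ennreal M * l y)"
  shows "K = functionals"
proof
  show K: "K \<subseteq> functionals"
    using \<open>subcone K\<close> unfolding subcone_def by blast
  show "functionals \<subseteq> K"
  proof (rule ccontr)
    assume "\<not> functionals \<subseteq> K"
    then obtain l where l: "l \<in> functionals" "l \<notin> K"
      by blast
    have le: "l x \<le> l y" if "\<And>k. k \<in> K \<Longrightarrow> k x \<le> k y" for x y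
      using le_on_functionals[OF assms(1,2,4) K assms(9) that l(1)] .
    have "l \<in> closure K"
      by (rule in_pointwise_closure,
          rule exists_in_subcone_between[OF \<open>subcone K\<close> assms(7) le l(1)]) blast+
    \<comment> \<open>The trace on \<open>K\<close> of the pointwise neighbourhoods of
      \<open>l\<close>. It is proper because \<open>l\<close> lies in the closure, and it converges
      to \<open>l\<close> in F(S), so it would eventually leave the closed set
      \<open>K\<close>.\<close>
    define F where "F = inf (nhds l) (principal K)"
    have "l islimpt K"
      using \<open>l \<in> closure K\<close> l(2) by (simp add: closure_def)
    then have "at l within K \<noteq> bot"
      by (simp add: trivial_limit_within)
    then have F: "F \<noteq> bot"
      using l(2) by (simp add: F_def at_within_def)
    have FK: "eventually (\<lambda>k. k \<in> K) F"
      unfolding F_def by (simp add: eventually_inf_principal)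
    have "functional_converges (\<lambda>k. k) l F"
    proof (rule functional_converges_of_pointwise[OF l(1) F])
      fix x
      show "((\<lambda>k. k x) \<longlongrightarrow> l x) F"
      proof (rule topological_tendstoI)
        fix U :: "ennreal set" assume U: "open U" "l x \<in> U"
        have "open ((\<lambda>k. k x) -` U)"
          using U(1) by (intro open_vimage) simp_all
        then have "eventually (\<lambda>k. k \<in> (\<lambda>k. k x) -` U) (nhds l)"
          using U(2) by (intro eventually_nhds_in_open) simp_all
        then show "eventually (\<lambda>k. k x \<in> U) F"
          unfolding F_def eventually_inf_principal by (rule eventually_mono) simp
      qed
    qed
    moreover have "openin functional_topology (functionals - K)"
      using \<open>closedin functional_topology K\<close> by (simp add: closedin_def)
    moreover have "F \<le> principal functionals"
      using K FK by (auto simp: le_principal elim: eventually_mono)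
    ultimately have "eventually (\<lambda>k. k \<in> functionals - K) F"
      using l unfolding openin_functional_topology by blast
    with FK have "eventually (\<lambda>_. False) F"
      by eventually_elim blast
    with F show False
      by simp
  qed
qed

end
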